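(* Let $f:[0,\infty)\to[0,\infty)$ be locally integrable and $\varphi(t)=\int_0^tf(s)\,\mathrm{d}s$. For integers $1\le k\le l$ and $t_k\ge0$ define $$A_k^l(t_k)=\big(k(k+1)\cdots l\big)\int_0^{t_k}\cdots\int_0^{t_l}\exp\Big(-\sum_{j=k}^lj\big(\varphi(t_j)-\varphi(t_{j+1})\big)\Big)f(t_{k+1})\cdots f(t_{l+1})\,\mathrm{d}t_{l+1}\cdots\mathrm{d}t_{k+1},$$ and, for $k<l$, $$B_k^l(t_k)=\big(k(k+1)\cdots(l-1)\big)\int_0^{t_k}\cdots\int_0^{t_{l-1}}\exp\Big(-\sum_{j=k}^{l-1}j\big(\varphi(t_j)-\varphi(t_{j+1})\big)-l\varphi(t_l)\Big)f(t_{k+1})\cdots f(t_l)\,\mathrm{d}t_l\cdots\mathrm{d}t_{k+1},$$ with $B_k^k(t)=e^{-k\varphi(t)}$. Then for all $1\le k\le l$ and $t\ge0$, $$A_k^l(t)=\frac{l!}{(l-k)!\,(k-1)!}\int_{e^{-\varphi(t)}}^1z^{k-1}(1-z)^{l-k}\,\mathrm{d}z,\qquad B_k^l(t)=\binom{l-1}{k-1}\big(1-e^{-\varphi(t)}\big)^{l-k}e^{-k\varphi(t)}.$$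
   Context: In the iterated integrals, $t_{j+1}$ ranges over $[0,t_j]$ for each $j$ (from $j=k$ up to $l$ for $A_k^l$, and up to $l-1$ for $B_k^l$). *)

theory Defs
  imports "HOL-Analysis.Analysis"
begin

definition locally_integrable :: "(real \<Rightarrow> real) \<Rightarrow> bool" where
  "locally_integrable f \<longleftrightarrow> (\<forall>K. compact K \<and> K \<subseteq> {0..} \<longrightarrow> set_integrable lebesgue K f)"

definition cumul :: "(real \<Rightarrow> real) \<Rightarrow> real \<Rightarrow> real" where
  "cumul f t = (LINT s:{0..t}|lebesgue. f s)"

text \<open>
  \<open>iter_int n j F \<tau>\<close> is the \<open>n\<close>-fold iterated integral
  \[ \int_0^{\tau_j} \int_0^{\tau_{j+1}} \cdots \int_0^{\tau_{j+n-1}} F(\tau)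
     \,d\tau_{j+n} \cdots d\tau_{j+2}\, d\tau_{j+1}. \]
  The point of integration is a sequence \<open>\<tau>\<close>; its entries up to index \<open>j\<close> are
  parameters, the entries \<open>j + 1, \<dots>, j + n\<close> are overwritten by the bound variables.
\<close>

primrec iter_int :: "nat \<Rightarrow> nat \<Rightarrow> ((nat \<Rightarrow> real) \<Rightarrow> real) \<Rightarrow> (nat \<Rightarrow> real) \<Rightarrow> real" where
  "iter_int 0 j F \<tau> = F \<tau>"
| "iter_int (Suc n) j F \<tau> =
     (LINT s:{0..\<tau> j}|lebesgue. iter_int n (Suc j) F (\<tau>(Suc j := s)))"

text \<open>
  Below, the initial sequence \<open>\<lambda>_. t\<close> only serves to set \<open>\<tau> k = t\<close>: the integrands depend
  on no other entry that is not integrated over.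
\<close>

definition A_int :: "(real \<Rightarrow> real) \<Rightarrow> nat \<Rightarrow> nat \<Rightarrow> real \<Rightarrow> real" where
  "A_int f k l t =
     (\<Prod>j=k..l. real j) *
     iter_int (l + 1 - k) k
       (\<lambda>\<tau>. exp (- (\<Sum>j=k..l. real j * (cumul f (\<tau> j) - cumul f (\<tau> (j + 1))))) *
            (\<Prod>j=k+1..l+1. f (\<tau> j)))
       (\<lambda>_. t)"

definition B_int :: "(real \<Rightarrow> real) \<Rightarrow> nat \<Rightarrow> nat \<Rightarrow> real \<Rightarrow> real" where
  "B_int f k l t =
     (if k = l then exp (- real k * cumul f t)
      else (\<Prod>j=k..l-1. real j) *
        iter_int (l - k) k
          (\<lambda>\<tau>. exp (- (\<Sum>j=k..l-1. real j * (cumul f (\<tau> j) - cumul f (\<tau> (j + 1))))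
                     - real l * cumul f (\<tau> l)) *
               (\<Prod>j=k+1..l. f (\<tau> j)))
          (\<lambda>_. t))"

end

theory Submission imports Defs begin

text \<open>
  Write \<open>\<phi>\<close> for \<open>cumul f\<close>. Both iterated integrals integrate a product of factors, each depending
  only on two consecutive variables: the kernels
  \<open>w\<^sub>i(t, s) = i exp(-i(\<phi>(t) - \<phi>(s))) f(s)\<close>, times a function of the last variable. Hence they
  satisfy the one-step recursion
  \<open>X\<^sub>i(t) = \<integral>\<^sub>0\<^sup>t w\<^sub>i(t, s) X\<^bsub>i+1\<^esub>(s) ds\<close>, and are determined by it together with the function at
  the innermost level (\<open>iter_int_prod_kernel\<close>): the constant 1 for \<open>A\<close>, and \<open>exp(-l\<phi>)\<close> for \<open>B\<close>. It
  remains to check that the closed forms obey the same recursion.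

  The closed forms depend on \<open>t\<close> only through \<open>u = \<phi>(t)\<close>. After the substitution \<open>u = \<phi>(s)\<close>, with
  \<open>du = f(s) ds\<close>, the recursion for \<open>X\<^sub>i(t) = x\<^sub>i(\<phi>(t))\<close> is the variation-of-constants formula for
  \<open>x\<^sub>i' = i (x\<^bsub>i+1\<^esub> - x\<^sub>i)\<close>, \<open>x\<^sub>i(0) = 0\<close> (\<open>integral_exp_kernel_cumul\<close>). As \<open>f\<close> is merely integrable,
  \<open>\<phi>\<close> need not be differentiable everywhere, and the substitution is proved by a direct estimate on
  short intervals (\<open>integral_comp_cumul\<close>).

  The differential equations are the backward Kolmogorov equations of the Yule process \<open>Y\<close>, which
  jumps from \<open>i\<close> to \<open>i + 1\<close> at rate \<open>i\<close>. Started in \<open>k\<close>, it is in state \<open>l\<close> at time \<open>u\<close> with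
  the negative binomial probability that is claimed for \<open>B\<close>, and it has passed \<open>l\<close> with the
  incomplete beta probability that is claimed for \<open>A\<close>. The equations themselves are elementary
  (\<open>upper_beta_exp_ode\<close>, \<open>yule_pmf_ode\<close>).
\<close>

section \<open>Iterated integrals of a product of kernels\<close>

text \<open>
  The integrations bind only the entries beyond \<open>j\<close>, so a factor that is a function of the entries up
  to \<open>j\<close> is constant in every one of them.
\<close>

lemma iter_int_mult_param:
  assumes "\<And>\<tau> \<tau>'. (\<And>i. i \<le> j \<Longrightarrow> \<tau> i = \<tau>' i) \<Longrightarrow> c \<tau> = c \<tau>'"
  shows "iter_int n j (\<lambda>\<tau>. c \<tau> * F \<tau>) \<tau> = c \<tau> * iter_int n j F \<tau>"
  using assms
proof (induction n arbitrary: j \<tau>)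
  case 0
  show ?case by (simp only: iter_int.simps)
next
  case (Suc n)
  have c: "c (\<tau>(Suc j := s)) = c \<tau>" for s
    by (rule Suc.prems) simp
  have "iter_int n (Suc j) (\<lambda>\<tau>. c \<tau> * F \<tau>) (\<tau>(Suc j := s))
      = c (\<tau>(Suc j := s)) * iter_int n (Suc j) F (\<tau>(Suc j := s))" for s
    by (rule Suc.IH) (rule Suc.prems, simp)
  then show ?case by (simp only: iter_int.simps set_integral_mult_right c)
qed

text \<open>
  The outermost kernel does not involve the inner variables, so it leaves the inner integrals, which
  by induction amount to the next function \<open>X (Suc j)\<close>.
\<close>

lemma iter_int_prod_kernel:
  fixes w :: "nat \<Rightarrow> real \<Rightarrow> real \<Rightarrow> real" and X :: "nat \<Rightarrow> real \<Rightarrow> real"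
  assumes "\<And>i t. j \<le> i \<Longrightarrow> i < j + n \<Longrightarrow> 0 \<le> t \<Longrightarrow>
      (LINT s:{0..t}|lebesgue. w i t s * X (Suc i) s) = X i t"
    and "0 \<le> \<tau> j"
  shows "iter_int n j (\<lambda>\<tau>. (\<Prod>i=j..<j+n. w i (\<tau> i) (\<tau> (Suc i))) * X (j + n) (\<tau> (j + n))) \<tau>
      = X j (\<tau> j)"
  using assms
proof (induction n arbitrary: j \<tau>)
  case (Suc n)
  let ?F = "\<lambda>\<tau>. (\<Prod>i=Suc j..<Suc j+n. w i (\<tau> i) (\<tau> (Suc i))) * X (Suc j + n) (\<tau> (Suc j + n))"
  have "(\<Prod>i=j..<j+Suc n. g i) = g j * (\<Prod>i=Suc j..<Suc j+n. g i)" for g :: "nat \<Rightarrow> real"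
    using prod.atLeast_Suc_lessThan[of j "j + Suc n" g] by (simp del: prod.op_ivl_Suc)
  then have split: "(\<lambda>\<tau>. (\<Prod>i=j..<j+Suc n. w i (\<tau> i) (\<tau> (Suc i))) * X (j + Suc n) (\<tau> (j + Suc n)))
      = (\<lambda>\<tau>. w j (\<tau> j) (\<tau> (Suc j)) * ?F \<tau>)"
    by (simp only: mult.assoc add_Suc_right add_Suc)
  have inner: "iter_int n (Suc j) (\<lambda>\<tau>. w j (\<tau> j) (\<tau> (Suc j)) * ?F \<tau>) (\<tau>(Suc j := s))
      = w j (\<tau> j) s * X (Suc j) s" if "0 \<le> s" for s
  proof -
    have "iter_int n (Suc j) ?F (\<tau>(Suc j := s)) = X (Suc j) ((\<tau>(Suc j := s)) (Suc j))"
      by (rule Suc.IH) (use Suc.prems(1) that in simp_all)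
    moreover have "iter_int n (Suc j) (\<lambda>\<tau>. w j (\<tau> j) (\<tau> (Suc j)) * ?F \<tau>) (\<tau>(Suc j := s))
        = w j ((\<tau>(Suc j := s)) j) ((\<tau>(Suc j := s)) (Suc j)) * iter_int n (Suc j) ?F (\<tau>(Suc j := s))"
      by (rule iter_int_mult_param) simp
    ultimately show ?thesis by simp
  qed
  have "iter_int (Suc n) j (\<lambda>\<tau>. w j (\<tau> j) (\<tau> (Suc j)) * ?F \<tau>) \<tau>
      = (LINT s:{0..\<tau> j}|lebesgue. w j (\<tau> j) s * X (Suc j) s)"
    unfolding iter_int.simps by (rule set_lebesgue_integral_cong, simp, intro allI impI inner, simp)
  also have "\<dots> = X j (\<tau> j)"
    using Suc.prems by simp
  finally show ?case unfolding split .
qed simp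

section \<open>Substitution along an indefinite integral\<close>

lemma locally_integrableD:
  assumes "locally_integrable f" "0 \<le> a"
  shows "f absolutely_integrable_on {a..b}"
  using assms unfolding locally_integrable_def by auto

lemma cumul_eq_integral:
  assumes "locally_integrable f"
  shows "cumul f t = integral {0..t} f"
  unfolding cumul_def
  by (rule set_lebesgue_integral_eq_integral(2)) (use locally_integrableD[OF assms] in auto)

lemma cumul_diff:
  assumes "locally_integrable f" "0 \<le> a" "a \<le> b"
  shows "cumul f b - cumul f a = integral {a..b} f"
proof -
  have "f integrable_on {0..b}"
    using locally_integrableD[OF assms(1)] by (simp add: set_lebesgue_integral_eq_integral(1))
  then show ?thesis
    using Henstock_Kurzweil_Integration.integral_combine[OF assms(2,3), of f]
    by (simp add: cumul_eq_integral[OF assms(1)] algebra_simps)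
qed

lemma continuous_on_cumul:
  assumes "locally_integrable f"
  shows "continuous_on {0..b} (cumul f)"
proof -
  have "f integrable_on {0..b}"
    using locally_integrableD[OF assms(1)] by (simp add: set_lebesgue_integral_eq_integral(1))
  then show ?thesis
    unfolding cumul_eq_integral[OF assms, abs_def] by (rule indefinite_integral_continuous_1)
qed

lemma cumul_mono:
  assumes "\<And>s. 0 \<le> s \<Longrightarrow> 0 \<le> f s" "locally_integrable f" "0 \<le> a" "a \<le> b"
  shows "cumul f a \<le> cumul f b"
proof -
  have "f integrable_on {a..b}"
    using locally_integrableD[OF assms(2,3)] by (simp add: set_lebesgue_integral_eq_integral(1))
  then have "0 \<le> integral {a..b} f"
    by (rule integral_nonneg) (use assms(1,3) in auto)
  then show ?thesis
    using cumul_diff[OF assms(2-4)] by simp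
qed

lemma cumul_0: "locally_integrable f \<Longrightarrow> cumul f 0 = 0"
  by (simp add: cumul_eq_integral)

lemma cumul_nonneg:
  assumes "\<And>s. 0 \<le> s \<Longrightarrow> 0 \<le> f s" "locally_integrable f" "0 \<le> t"
  shows "0 \<le> cumul f t"
  using cumul_mono[OF assms(1,2) order_refl assms(3)] by (simp add: cumul_0[OF assms(2)])

lemma integrable_comp_cumul:
  assumes nonneg: "\<And>s. 0 \<le> s \<Longrightarrow> 0 \<le> f s"
    and loc: "locally_integrable f"
    and g: "continuous_on {0..} g"
    and "0 \<le> a"
  shows "(\<lambda>s. g (cumul f s) * f s) absolutely_integrable_on {a..b}"
proof (rule absolutely_integrable_bounded_measurable_product_real)
  have "continuous_on {0..b} (\<lambda>s. g (cumul f s))"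
    by (rule continuous_on_compose2[OF g continuous_on_cumul[OF loc]])
      (auto intro: cumul_nonneg[OF nonneg loc])
  then have cont: "continuous_on {a..b} (\<lambda>s. g (cumul f s))"
    by (rule continuous_on_subset) (use \<open>0 \<le> a\<close> in auto)
  show "(\<lambda>s. g (cumul f s)) \<in> borel_measurable (lebesgue_on {a..b})"
    by (rule continuous_imp_measurable_on_sets_lebesgue[OF cont]) simp
  show "bounded ((\<lambda>s. g (cumul f s)) ` {a..b})"
    by (rule compact_imp_bounded[OF compact_continuous_image[OF cont]]) simp
qed (use locally_integrableD[OF loc \<open>0 \<le> a\<close>] in auto)

text \<open>
  The substitution \<open>u = \<phi>(s)\<close>. On a short interval around \<open>x\<close>, the values of \<open>g\<close> differ from
  \<open>g(\<phi>(x))\<close> by at most \<open>e/2\<close>, so both the integral and (by the mean value theorem) the increment of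
  \<open>G \<circ> \<phi>\<close> are \<open>g(\<phi>(x))\<close> times the increment of \<open>\<phi>\<close>, up to \<open>e/2\<close> times that increment. The
  resulting bound on the discrepancy \<open>H\<close> is additive over adjacent intervals and therefore passes to
  \<open>[0, t]\<close>; then let \<open>e\<close> tend to 0.
\<close>

lemma integral_comp_cumul:
  fixes f g G :: "real \<Rightarrow> real"
  assumes nonneg: "\<And>s. 0 \<le> s \<Longrightarrow> 0 \<le> f s"
    and loc: "locally_integrable f"
    and deriv: "\<And>u. 0 \<le> u \<Longrightarrow> (G has_real_derivative g u) (at u within {0..})"
    and cont: "continuous_on {0..} g"
    and "0 \<le> t"
  shows "(LINT s:{0..t}|lebesgue. g (cumul f s) * f s) = G (cumul f t) - G 0"
proof -
  let ?\<phi> = "cumul f"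
  have int: "f integrable_on {a..b}" if "0 \<le> a" for a b
    using locally_integrableD[OF loc that] by (simp add: set_lebesgue_integral_eq_integral(1))
  have mono: "?\<phi> a \<le> ?\<phi> b" if "0 \<le> a" "a \<le> b" for a b
    using cumul_mono[OF _ loc that] nonneg by blast
  have pos: "0 \<le> ?\<phi> s" if "0 \<le> s" for s
    using cumul_nonneg[OF _ loc that] nonneg by blast
  have abs_int: "(\<lambda>s. g (?\<phi> s) * f s) absolutely_integrable_on {a..b}" if "0 \<le> a" for a b
    using integrable_comp_cumul[OF _ loc cont that] nonneg by blast
  note \<phi>0 = cumul_0[OF loc]
  have intg: "(\<lambda>s. g (?\<phi> s) * f s) integrable_on {a..b}" if "0 \<le> a" for a b
    using abs_int[OF that] by (simp add: set_lebesgue_integral_eq_integral(1))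
  define H where "H a b = G (?\<phi> b) - G (?\<phi> a) - integral {a..b} (\<lambda>s. g (?\<phi> s) * f s)" for a b
  have small: "\<bar>H 0 t\<bar> \<le> e * (?\<phi> t - ?\<phi> 0)" if "0 < e" for e
  proof -
    define P where "P = (\<lambda>a b. 0 \<le> a \<and> b \<le> t \<longrightarrow> \<bar>H a b\<bar> \<le> e * (?\<phi> b - ?\<phi> a))"
    have "P 0 t"
      \<comment> \<open>Bolzano's principle turns a property of short intervals that is stable under
          concatenation into one of the whole interval.\<close>
    proof (rule Bolzano[OF \<open>0 \<le> t\<close>])
      fix a b c assume *: "P a b" "P b c" "a \<le> b" "b \<le> c"
      show "P a c"
        unfolding P_def
      proof
        assume bds: "0 \<le> a \<and> c \<le> t"
        then have "H a c = H a b + H b c"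
          using Henstock_Kurzweil_Integration.integral_combine[OF *(3,4) intg] by (simp add: H_def)
        moreover have "\<bar>H a b\<bar> \<le> e * (?\<phi> b - ?\<phi> a)" "\<bar>H b c\<bar> \<le> e * (?\<phi> c - ?\<phi> b)"
          using * bds by (auto simp: P_def)
        ultimately show "\<bar>H a c\<bar> \<le> e * (?\<phi> c - ?\<phi> a)"
          by (auto simp: algebra_simps)
      qed
    next
      fix x assume x: "0 \<le> x" "x \<le> t"
      obtain d1 where d1: "0 < d1" "\<And>v. 0 \<le> v \<Longrightarrow> dist v (?\<phi> x) < d1 \<Longrightarrow> dist (g v) (g (?\<phi> x)) < e/2"
        using cont[unfolded continuous_on_iff, rule_format, of "?\<phi> x" "e/2"] pos[OF x(1)] \<open>0 < e\<close> by auto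
      obtain d where d: "0 < d" "\<And>s. 0 \<le> s \<Longrightarrow> s \<le> t \<Longrightarrow> dist s x < d \<Longrightarrow> dist (?\<phi> s) (?\<phi> x) < d1"
        using continuous_on_cumul[OF loc, unfolded continuous_on_iff, rule_format, of x t d1] x d1(1) by auto
      have "P a b" if ab: "a \<le> x" "x \<le> b" "b - a < d" for a b
        unfolding P_def
      proof
        assume bds: "0 \<le> a \<and> b \<le> t"
        have near: "dist (?\<phi> s) (?\<phi> x) < d1" if "a \<le> s" "s \<le> b" for s
          using d(2)[of s] that ab bds by (auto simp: dist_real_def)
        let ?c = "g (?\<phi> x)" and ?L = "?\<phi> b - ?\<phi> a"
        have L0: "0 \<le> ?L" using mono[of a b] ab bds by auto
        have L: "integral {a..b} f = ?L" using cumul_diff[OF loc, of a b] ab bds by auto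
        have "\<exists>v\<in>{?\<phi> a..?\<phi> b}. G (?\<phi> b) - G (?\<phi> a) = g v * ?L"
          by (rule mvt_very_simple[where f=G and f'="\<lambda>v h. g v * h"])
            (use L0 pos[of a] bds in \<open>auto simp: has_field_derivative_def intro!:
              has_derivative_subset[OF deriv[unfolded has_field_derivative_def]]\<close>)
        then obtain v where v: "?\<phi> a \<le> v" "v \<le> ?\<phi> b" "G (?\<phi> b) - G (?\<phi> a) = g v * ?L" by auto
        have "dist v (?\<phi> x) < d1"
          using near[of a] near[of b] ab v by (auto simp: dist_real_def)
        then have "\<bar>g v - ?c\<bar> \<le> e/2"
          using d1(2)[of v] v pos[of a] bds by (auto simp: dist_real_def)
        then have 1: "\<bar>(g v - ?c) * ?L\<bar> \<le> e/2 * ?L"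
          unfolding abs_mult abs_of_nonneg[OF L0] by (rule mult_right_mono[OF _ L0])
        have "\<bar>g (?\<phi> s) - ?c\<bar> * f s \<le> e/2 * f s" if "s \<in> {a..b}" for s
          using d1(2)[of "?\<phi> s"] near[of s] pos[of s] nonneg[of s] that bds
          by (intro mult_right_mono) (auto simp: dist_real_def)
        then have "norm (integral {a..b} (\<lambda>s. g (?\<phi> s) * f s - ?c * f s)) \<le> integral {a..b} (\<lambda>s. e/2 * f s)"
          using bds
          by (intro integral_norm_bound_integral integrable_diff integrable_on_mult_right int intg)
            (auto simp: abs_mult nonneg simp flip: left_diff_distrib)
        also have "integral {a..b} (\<lambda>s. g (?\<phi> s) * f s - ?c * f s)
            = integral {a..b} (\<lambda>s. g (?\<phi> s) * f s) - ?c * ?L"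
          using bds L by (subst Henstock_Kurzweil_Integration.integral_diff[OF intg integrable_on_mult_right[OF int]]) auto
        also have "integral {a..b} (\<lambda>s. e/2 * f s) = e/2 * ?L"
          using L by simp
        finally have 2: "\<bar>integral {a..b} (\<lambda>s. g (?\<phi> s) * f s) - ?c * ?L\<bar> \<le> e/2 * ?L" by simp
        have "H a b = (g v - ?c) * ?L - (integral {a..b} (\<lambda>s. g (?\<phi> s) * f s) - ?c * ?L)"
          unfolding H_def v(3) by (simp add: algebra_simps)
        then show "\<bar>H a b\<bar> \<le> e * ?L" using 1 2 by linarith
      qed
      then show "\<exists>d>0. \<forall>a b. a \<le> x \<and> x \<le> b \<and> b - a < d \<longrightarrow> P a b"
        using d(1) by blast
    qed
    then show ?thesis by (simp add: P_def)
  qed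
  have "\<bar>H 0 t\<bar> \<le> 0"
  proof (rule field_le_epsilon)
    fix e :: real assume "0 < e"
    \<comment> \<open>The summand 1 keeps the divisor positive when \<open>\<phi>(t) = 0\<close>.\<close>
    have "e / (1 + ?\<phi> t) * ?\<phi> t \<le> e"
      using \<open>0 < e\<close> pos[OF \<open>0 \<le> t\<close>] by (simp add: field_simps)
    then show "\<bar>H 0 t\<bar> \<le> 0 + e"
      using small[of "e / (1 + ?\<phi> t)"] \<open>0 < e\<close> pos[OF \<open>0 \<le> t\<close>] by (simp add: \<phi>0)
  qed
  moreover have "(LINT s:{0..t}|lebesgue. g (?\<phi> s) * f s) = integral {0..t} (\<lambda>s. g (?\<phi> s) * f s)"
    by (rule set_lebesgue_integral_eq_integral(2)[OF abs_int]) simp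
  ultimately show ?thesis by (simp add: H_def \<phi>0)
qed

text \<open>
  The equation for \<open>x\<close> says that \<open>exp(k u) x(u)\<close> has derivative \<open>k exp(k u) y(u)\<close>.
  Substituting \<open>u = \<phi>(s)\<close> integrates the latter, and the factor \<open>exp(-k\<phi>(t))\<close> of the kernel cancels
  the exponential.
\<close>

lemma integral_exp_kernel_cumul:
  fixes f x y :: "real \<Rightarrow> real" and k :: nat
  assumes nonneg: "\<And>s. 0 \<le> s \<Longrightarrow> 0 \<le> f s"
    and loc: "locally_integrable f"
    and ode: "\<And>u. 0 \<le> u \<Longrightarrow> (x has_real_derivative real k * (y u - x u)) (at u within {0..})"
    and cont: "continuous_on {0..} y"
    and "x 0 = 0" "0 \<le> t"
  shows "(LINT s:{0..t}|lebesgue.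
      (real k * exp (- (real k * (cumul f t - cumul f s))) * f s) * y (cumul f s)) = x (cumul f t)"
proof -
  let ?g = "\<lambda>u. real k * exp (real k * u) * y u"
  have "(LINT s:{0..t}|lebesgue. ?g (cumul f s) * f s)
      = exp (real k * cumul f t) * x (cumul f t) - exp (real k * 0) * x 0"
  proof (rule integral_comp_cumul[OF nonneg loc])
    fix u :: real assume "0 \<le> u"
    show "((\<lambda>u. exp (real k * u) * x u) has_real_derivative ?g u) (at u within {0..})"
      by (rule derivative_eq_intros ode[OF \<open>0 \<le> u\<close>] refl | simp add: algebra_simps)+
  qed (use assms in \<open>auto intro!: continuous_intros\<close>)
  moreover have "(real k * exp (- (real k * (cumul f t - cumul f s))) * f s) * y (cumul f s)
      = exp (- (real k * cumul f t)) * (?g (cumul f s) * f s)" for s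
  proof -
    have "exp (- (real k * (cumul f t - cumul f s))) = exp (- (real k * cumul f t)) * exp (real k * cumul f s)"
      by (simp add: algebra_simps flip: exp_add)
    then show ?thesis by (simp only: mult_ac)
  qed
  ultimately show ?thesis
    by (simp only: set_integral_mult_right) (simp add: \<open>x 0 = 0\<close> flip: exp_add mult.assoc)
qed

section \<open>The regularised incomplete beta function\<close>

text \<open>
  For \<open>1 \<le> k \<le> l\<close> this is the probability that fewer than \<open>k\<close> out of \<open>l\<close> independent trials with
  success probability \<open>x \<in> [0, 1]\<close> succeed. The value 1 for \<open>k > l\<close> continues this interpretation and starts
  the recursion from \<open>k = l + 1\<close>.
\<close>

definition upper_beta :: "nat \<Rightarrow> nat \<Rightarrow> real \<Rightarrow> real" where
  "upper_beta k l x = (if l < k then 1 else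
     real k * real (l choose k) * integral {x..1} (\<lambda>z. z ^ (k - 1) * (1 - z) ^ (l - k)))"

lemma choose_Suc_mult_Suc: "Suc k * (n choose Suc k) = (n - k) * (n choose k)"
  using binomial_absorb_comp[of n k] binomial_absorption[of k n] by simp

lemma beta_const:
  assumes "1 \<le> k" "k \<le> l"
  shows "fact l / (fact (l - k) * fact (k - 1)) = real k * real (l choose k)"
proof -
  have "fact k = real k * fact (k - 1)"
    using assms by (simp add: fact_reduce)
  then show ?thesis using assms by (simp add: binomial_fact)
qed

text \<open>
  Fewer than \<open>k + 1\<close> successes are fewer than \<open>k\<close> or exactly \<open>k\<close>. Analytically, this is the
  fundamental theorem of calculus for the last term, whose derivative is the difference of the two
  beta densities.
\<close>

lemma upper_beta_Suc:
  assumes "1 \<le> k" "k \<le> l" "x \<le> 1"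
  shows "upper_beta (Suc k) l x = upper_beta k l x + real (l choose k) * x ^ k * (1 - x) ^ (l - k)"
proof -
  let ?C = "real (l choose k)"
  let ?F = "\<lambda>z::real. ?C * z ^ k * (1 - z) ^ (l - k)"
  let ?p = "\<lambda>z::real. z ^ (k - 1) * (1 - z) ^ (l - k)"
  let ?q = "\<lambda>z::real. z ^ k * (1 - z) ^ (l - Suc k)"
  let ?c = "real k * ?C" and ?d = "real (l - k) * ?C"
  have int: "?p integrable_on {x..1}" "?q integrable_on {x..1}"
    by (auto intro!: integrable_continuous_interval continuous_intros)
  \<comment> \<open>If \<open>k = l\<close>, the exponent in \<open>?q\<close> is truncated, but its coefficient \<open>?d\<close> is 0.\<close>
  have "((\<lambda>z. ?c * ?p z - ?d * ?q z) has_integral ?F 1 - ?F x) {x..1}"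
  proof (rule fundamental_theorem_of_calculus[OF \<open>x \<le> 1\<close>])
    fix z :: real
    show "(?F has_vector_derivative ?c * ?p z - ?d * ?q z) (at z within {x..1})"
      unfolding has_real_derivative_iff_has_vector_derivative[symmetric]
      by (rule derivative_eq_intros refl | simp add: algebra_simps)+
  qed
  then have *: "?F 1 - ?F x = ?c * integral {x..1} ?p - ?d * integral {x..1} ?q"
    by (rule has_integral_unique)
      (intro has_integral_diff has_integral_mult_right integrable_integral int)
  have A: "upper_beta k l x = ?c * integral {x..1} ?p"
    using assms by (simp add: upper_beta_def)
  show ?thesis
  proof (cases "k = l")
    case True
    with * A show ?thesis by (simp add: upper_beta_def)
  next
    case False
    then have "k < l" using assms by simp
    have "real (Suc k) * real (l choose Suc k) = ?d"
      using choose_Suc_mult_Suc[of k l] by (metis of_nat_mult)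
    then have "upper_beta (Suc k) l x = ?d * integral {x..1} ?q"
      using \<open>k < l\<close> by (simp add: upper_beta_def)
    moreover have "?F 1 = 0" using \<open>k < l\<close> by simp
    ultimately show ?thesis using * A by linarith
  qed
qed

lemma upper_beta_has_derivative:
  assumes "1 \<le> k" "k \<le> l" "0 \<le> x" "x \<le> 1"
  shows "(upper_beta k l has_real_derivative
     - (real k * real (l choose k) * (x ^ (k - 1) * (1 - x) ^ (l - k)))) (at x within {0..1})"
proof -
  let ?p = "\<lambda>z::real. z ^ (k - 1) * (1 - z) ^ (l - k)"
  let ?c = "real k * real (l choose k)"
  have cont: "continuous_on {0..1} ?p" by (intro continuous_intros)
  have deriv: "((\<lambda>x. ?c * (integral {0..1} ?p - integral {0..x} ?p)) has_real_derivative - (?c * ?p x)) (at x within {0..1})"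
    by (rule derivative_eq_intros integral_has_real_derivative[OF cont] refl | use assms in simp)+
  have eq: "?c * (integral {0..1} ?p - integral {0..y} ?p) = upper_beta k l y" if "y \<in> {0..1}" for y
  proof -
    have "integral {0..1} ?p - integral {0..y} ?p = integral {y..1} ?p"
      using that Henstock_Kurzweil_Integration.integral_combine[of 0 y 1 ?p] integrable_continuous_interval[OF cont]
      by auto
    then show ?thesis using assms by (simp add: upper_beta_def)
  qed
  show ?thesis
    by (rule has_field_derivative_transform_within[OF deriv zero_less_one _ eq]) (use assms in simp_all)
qed

text \<open>
  By the chain rule, the derivative is \<open>k\<close> times the binomial term in \<open>upper_beta_Suc\<close>, with
  \<open>x = exp(-u)\<close>.
\<close>

lemma upper_beta_exp_ode:
  assumes "1 \<le> k" "k \<le> l" "0 \<le> u"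
  shows "((\<lambda>u. upper_beta k l (exp (- u))) has_real_derivative
     real k * (upper_beta (Suc k) l (exp (- u)) - upper_beta k l (exp (- u)))) (at u within {0..})"
proof -
  let ?x = "exp (- u)"
  have "(upper_beta k l has_real_derivative
     - (real k * real (l choose k) * (?x ^ (k - 1) * (1 - ?x) ^ (l - k)))) (at ?x within ((\<lambda>u. exp (- u)) ` {0..}))"
    by (rule DERIV_subset[OF upper_beta_has_derivative]) (use assms in auto)
  moreover have "((\<lambda>u. exp (- u)) has_real_derivative - ?x) (at u within {0..})"
    by (rule derivative_eq_intros refl | simp)+
  ultimately have "((upper_beta k l \<circ> (\<lambda>u. exp (- u))) has_real_derivative
     - (real k * real (l choose k) * (?x ^ (k - 1) * (1 - ?x) ^ (l - k))) * - ?x) (at u within {0..})"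
    by (rule DERIV_image_chain)
  moreover have "?x ^ k = ?x * ?x ^ (k - 1)"
    using assms by (simp flip: power_Suc)
  ultimately show ?thesis
    using upper_beta_Suc[of k l ?x] assms by (simp add: o_def algebra_simps)
qed

lemma continuous_on_upper_beta_exp:
  assumes "1 \<le> k"
  shows "continuous_on {0..} (\<lambda>u. upper_beta k l (exp (- u)))"
proof (cases "k \<le> l")
  case True
  then show ?thesis
    using upper_beta_exp_ode[OF assms] by (intro DERIV_continuous_on) auto
qed (simp add: upper_beta_def)

section \<open>The Yule process and the closed forms\<close>

text \<open>
  The probability that the Yule process moves from \<open>k\<close> to \<open>l\<close> in time \<open>u\<close>, for \<open>1 \<le> k \<le> l\<close>.
\<close>

definition yule_pmf :: "nat \<Rightarrow> nat \<Rightarrow> real \<Rightarrow> real" where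
  "yule_pmf k l u = real ((l - 1) choose (k - 1)) * (1 - exp (- u)) ^ (l - k) * exp (- real k * u)"

text \<open>
  Differentiating the exponential gives \<open>-k x\<^sub>k\<close>. Differentiating the power of \<open>1 - exp(-u)\<close> gives
  the term for \<open>k + 1\<close>, because \<open>(l - k) (l-1 choose k-1) = k (l-1 choose k)\<close>. The case \<open>k = l\<close> is
  excluded: there the derivative is \<open>-k x\<^sub>k\<close>, with \<open>x\<^sub>k(0) = 1\<close>.
\<close>

lemma yule_pmf_ode:
  assumes "1 \<le> k" "k < l"
  shows "(yule_pmf k l has_real_derivative real k * (yule_pmf (Suc k) l u - yule_pmf k l u)) (at u within S)"
proof -
  obtain m where k: "k = Suc m" using assms by (cases k) auto
  obtain n where l: "l = Suc (Suc (m + n))" using assms k less_iff_Suc_add by auto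
  have *: "real (Suc n) * real (Suc (m + n) choose m) = real (Suc m) * real (Suc (m + n) choose Suc m)"
    using choose_Suc_mult_Suc[of m "Suc (m + n)"]
    by (metis Suc_diff_le diff_add_inverse le_add1 of_nat_mult)
  have "(yule_pmf k l has_real_derivative
      real (Suc n) * real (Suc (m + n) choose m) * (1 - exp (- u)) ^ n * exp (- u) * exp (- real k * u)
      - real k * yule_pmf k l u) (at u within S)"
    unfolding yule_pmf_def[abs_def] k l
    by (rule derivative_eq_intros refl | simp add: algebra_simps)+
  moreover have "exp (- u) * exp (- real k * u) = exp (- real (Suc k) * u)"
    by (simp add: algebra_simps flip: exp_add)
  ultimately have "(yule_pmf k l has_real_derivative
      real k * (real (Suc (m + n) choose Suc m) * (1 - exp (- u)) ^ n * exp (- real (Suc k) * u))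
      - real k * yule_pmf k l u) (at u within S)"
    unfolding * k by (simp only: mult.assoc)
  moreover have "yule_pmf (Suc k) l u
      = real (Suc (m + n) choose Suc m) * (1 - exp (- u)) ^ n * exp (- real (Suc k) * u)"
    by (simp add: yule_pmf_def k l)
  ultimately show ?thesis
    by (simp only: right_diff_distrib)
qed

theorem lemma2p6:
  fixes f :: "real \<Rightarrow> real" and k l :: nat and t :: real
  assumes "\<And>s. 0 \<le> s \<Longrightarrow> 0 \<le> f s"
    and "locally_integrable f"
    and "1 \<le> k" and "k \<le> l" and "0 \<le> t"
  shows "A_int f k l t =
           fact l / (fact (l - k) * fact (k - 1)) *
           (LINT z:{exp (- cumul f t)..1}|lebesgue. z ^ (k - 1) * (1 - z) ^ (l - k))
       \<and> B_int f k l t =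
           real ((l - 1) choose (k - 1)) * (1 - exp (- cumul f t)) ^ (l - k) *
           exp (- real k * cumul f t)"
proof
  let ?\<phi> = "cumul f"
  define w where "w i t s = real i * exp (- (real i * (?\<phi> t - ?\<phi> s))) * f s" for i t s
  let ?X = "\<lambda>i t. upper_beta i l (exp (- ?\<phi> t))"
  have stepA: "(LINT s:{0..t}|lebesgue. w i t s * ?X (Suc i) s) = ?X i t"
    if "1 \<le> i" "i \<le> l" "0 \<le> t" for i t
    unfolding w_def using that
    by (intro integral_exp_kernel_cumul[OF assms(1,2) upper_beta_exp_ode continuous_on_upper_beta_exp])
      (auto simp: upper_beta_def)
  have kernels: "(\<Prod>i\<in>S. w i (\<tau> i) (\<tau> (Suc i)))
      = (\<Prod>i\<in>S. real i) * (exp (- (\<Sum>i\<in>S. real i * (?\<phi> (\<tau> i) - ?\<phi> (\<tau> (i + 1))))) * (\<Prod>i\<in>S. f (\<tau> (Suc i))))"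
    if "finite S" for S and \<tau> :: "nat \<Rightarrow> real"
  proof -
    have "exp (- (\<Sum>i\<in>S. real i * (?\<phi> (\<tau> i) - ?\<phi> (\<tau> (i + 1)))))
        = (\<Prod>i\<in>S. exp (- (real i * (?\<phi> (\<tau> i) - ?\<phi> (\<tau> (Suc i))))))"
      unfolding sum_negf[symmetric] Suc_eq_plus1 by (rule exp_sum[OF that])
    then show ?thesis by (simp only: w_def prod.distrib mult.assoc)
  qed

  have integrandA: "(\<Prod>j=k..l. real j) *
      (exp (- (\<Sum>j=k..l. real j * (?\<phi> (\<tau> j) - ?\<phi> (\<tau> (j + 1))))) * (\<Prod>j=k+1..l+1. f (\<tau> j)))
      = (\<Prod>i=k..<k+(l+1-k). w i (\<tau> i) (\<tau> (Suc i))) * ?X (k + (l+1-k)) (\<tau> (k + (l+1-k)))"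
    for \<tau> :: "nat \<Rightarrow> real"
  proof -
    have "k + (l+1-k) = Suc l" using assms by simp
    then have "{k..<k+(l+1-k)} = {k..l}" by (simp only: atLeastLessThanSuc_atLeastAtMost)
    moreover have "(\<Prod>j=k+1..l+1. f (\<tau> j)) = (\<Prod>j=k..l. f (\<tau> (Suc j)))"
      using prod.shift_bounds_cl_Suc_ivl[of "\<lambda>j. f (\<tau> j)" k l] by simp
    moreover have "?X (k + (l+1-k)) s = 1" for s
      using assms by (simp add: upper_beta_def)
    ultimately show ?thesis by (simp only: kernels finite_atLeastAtMost mult_1_right)
  qed
  have "A_int f k l t = iter_int (l + 1 - k) k
      (\<lambda>\<tau>. (\<Prod>i=k..<k+(l+1-k). w i (\<tau> i) (\<tau> (Suc i))) * ?X (k + (l+1-k)) (\<tau> (k + (l+1-k)))) (\<lambda>_. t)"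
    unfolding A_int_def integrandA[symmetric] by (subst iter_int_mult_param) simp_all
  also have "\<dots> = ?X k t"
    using assms by (intro iter_int_prod_kernel[where w = w and X = ?X] stepA) simp_all
  also have "\<dots> = fact l / (fact (l - k) * fact (k - 1)) *
      (LINT z:{exp (- ?\<phi> t)..1}|lebesgue. z ^ (k - 1) * (1 - z) ^ (l - k))"
    unfolding beta_const[OF assms(3,4)]
    using assms set_lebesgue_integral_eq_integral(2)[OF absolutely_integrable_continuous_real,
        of "exp (- ?\<phi> t)" 1 "\<lambda>z. z ^ (k - 1) * (1 - z) ^ (l - k)"]
    by (simp add: upper_beta_def continuous_intros)
  finally show "A_int f k l t = \<dots>" .

  let ?Y = "\<lambda>i t. yule_pmf i l (?\<phi> t)"
  have stepB: "(LINT s:{0..t}|lebesgue. w i t s * ?Y (Suc i) s) = ?Y i t"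
    if "1 \<le> i" "i < l" "0 \<le> t" for i t
    unfolding w_def using that
    by (intro integral_exp_kernel_cumul[OF assms(1,2) yule_pmf_ode])
      (auto simp: yule_pmf_def[abs_def] intro!: continuous_intros)
  have "B_int f k l t = ?Y k t"
  proof (cases "k = l")
    case True
    then show ?thesis by (simp add: B_int_def yule_pmf_def)
  next
    case False
    have integrandB: "(\<Prod>j=k..l-1. real j) *
        (exp (- (\<Sum>j=k..l-1. real j * (?\<phi> (\<tau> j) - ?\<phi> (\<tau> (j + 1)))) - real l * ?\<phi> (\<tau> l)) * (\<Prod>j=k+1..l. f (\<tau> j)))
        = (\<Prod>i=k..<k+(l-k). w i (\<tau> i) (\<tau> (Suc i))) * ?Y (k + (l-k)) (\<tau> (k + (l-k)))"
      for \<tau> :: "nat \<Rightarrow> real"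
    proof -
      have kl: "k + (l-k) = l" using assms by simp
      have "{k..<l} = {k..l-1}"
        using atLeastLessThanSuc_atLeastAtMost[of k "l-1"] assms by simp
      moreover have "(\<Prod>j=k+1..l. f (\<tau> j)) = (\<Prod>j=k..l-1. f (\<tau> (Suc j)))"
        using prod.shift_bounds_cl_Suc_ivl[of "\<lambda>j. f (\<tau> j)" k "l-1"] assms by simp
      moreover have "?Y l s = exp (- (real l * ?\<phi> s))" for s
        using assms by (simp add: yule_pmf_def)
      moreover have "exp (a - b) = exp a * exp (- b)" for a b :: real
        by (simp flip: exp_add)
      ultimately show ?thesis
        unfolding kl
        by (simp only: kernels finite_atLeastAtMost mult.assoc mult.left_commute mult.commute)
    qed
    have "B_int f k l t = iter_int (l - k) k
        (\<lambda>\<tau>. (\<Prod>i=k..<k+(l-k). w i (\<tau> i) (\<tau> (Suc i))) * ?Y (k + (l-k)) (\<tau> (k + (l-k)))) (\<lambda>_. t)"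
      unfolding B_int_def integrandB[symmetric] using False by (subst iter_int_mult_param) simp_all
    also have "\<dots> = ?Y k t"
      using assms by (intro iter_int_prod_kernel[where w = w and X = ?Y] stepB) simp_all
    finally show ?thesis .
  qed
  then show "B_int f k l t = real ((l - 1) choose (k - 1)) * (1 - exp (- ?\<phi> t)) ^ (l - k) *
           exp (- real k * ?\<phi> t)"
    by (simp add: yule_pmf_def)
qed

end
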